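(* Let $m\ge1$ and let $a,b$ be integers with $m\le a<b$ such that $a\not\equiv-1$ and $b\not\equiv-1 \pmod p$ for every prime divisor $p$ of $m$. Then for any $0\le\ell\le m-1$, the sum of the coefficients of $q^{i}$ over all $i\equiv\ell\pmod m$ in the polynomial $$\sum_{j=a+1}^{b}q^{\,j-(a+1)}\begin{bmatrix} j-1 \\ m-2 \end{bmatrix}_q$$ is equal to $$\frac1m\sum_{j=a+1}^{b}\binom{j-1}{m-2}.$$
   Context: The Gaussian polynomial is $\begin{bmatrix} N \\ t \end{bmatrix}_q=\dfrac{(1-q^{N-t+1})\cdots(1-q^{N})}{(1-q)\cdots(1-q^{t})}$ for $0\le t\le N$. Both $\begin{bmatrix} N \\ t \end{bmatrix}_q$ and $\binom Nt$ are $0$ when $t<0$ (relevant only for $m=1$). *)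

theory Defs
  imports Complex_Main "HOL-Computational_Algebra.Polynomial" "HOL-Number_Theory.Cong"
begin

(* The quotient is taken with the exact division of int poly; gauss_poly_mult_denominator
   below shows that the denominator does divide the numerator. *)
definition gauss_poly :: "int \<Rightarrow> int \<Rightarrow> int poly" where
  "gauss_poly N t =
     (if 0 \<le> t \<and> t \<le> N
      then (\<Prod>k=N-t+1..N. 1 - monom 1 (nat k)) div (\<Prod>k=1..t. 1 - monom 1 (nat k))
      else 0)"

definition int_binomial :: "int \<Rightarrow> int \<Rightarrow> nat" where
  "int_binomial N t = (if 0 \<le> t \<and> t \<le> N then nat N choose nat t else 0)"

definition coeff_sum_mod :: "int poly \<Rightarrow> int \<Rightarrow> int \<Rightarrow> int" where
  "coeff_sum_mod P m l = (\<Sum>i | i \<le> degree P \<and> [int i = l] (mod m). coeff P i)"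

lemma gauss_denominator_dvd_nat:
  "(\<Prod>i<t. 1 - monom 1 (Suc i) :: int poly) dvd (\<Prod>i<t. 1 - monom 1 (N - i))"
proof (induction N arbitrary: t)
  case 0
  show ?case
    by (cases t) (auto simp: prod.lessThan_Suc_shift monom_0 one_pCons simp del: prod.lessThan_Suc)
next
  case (Suc N)
  show ?case
  proof (cases t)
    case 0
    then show ?thesis by simp
  next
    case (Suc s)
    let ?n = "\<lambda>s. \<Prod>i<s. 1 - monom 1 (N - i) :: int poly"
    let ?d = "\<lambda>s. \<Prod>i<s. 1 - monom 1 (Suc i) :: int poly"
    have num: "(\<Prod>i<t. 1 - monom 1 (Suc N - i) :: int poly) = (1 - monom 1 (Suc N)) * ?n s"
      unfolding Suc by (simp add: prod.lessThan_Suc_shift del: prod.lessThan_Suc)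
    have "?d (Suc s) dvd (1 - monom 1 (Suc N)) * ?n s"
    proof (cases "s \<le> N")
      case True
      have "(1 - monom 1 (Suc N) :: int poly)
              = (1 - monom 1 (N - s)) + monom 1 (N - s) * (1 - monom 1 (Suc s))"
        using True by (simp add: algebra_simps mult_monom)
      then have eq: "(1 - monom 1 (Suc N)) * ?n s
          = ?n (Suc s) + monom 1 (N - s) * (?n s * (1 - monom 1 (Suc s)))"
        by (simp add: algebra_simps)
      have "?d (Suc s) dvd ?n s * (1 - monom 1 (Suc s))"
        using Suc.IH[of s] by (simp add: mult_dvd_mono del: One_nat_def)
      then show ?thesis
        unfolding eq by (rule dvd_add[OF Suc.IH[of "Suc s"] dvd_mult])
    next
      case False
      then have "?n s = 0"
        by (intro prod_zero) (auto intro!: bexI[of _ N] simp: monom_0 one_pCons)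
      then show ?thesis by (simp only: mult_zero_right dvd_0_right)
    qed
    then show ?thesis unfolding num unfolding Suc .
  qed
qed

lemma gauss_poly_mult_denominator:
  assumes "0 \<le> t" "t \<le> N"
  shows "gauss_poly N t * (\<Prod>k=1..t. 1 - monom 1 (nat k)) = (\<Prod>k=N-t+1..N. 1 - monom 1 (nat k))"
proof -
  have d: "(\<Prod>k=1..t. 1 - monom 1 (nat k) :: int poly) = (\<Prod>i<nat t. 1 - monom 1 (Suc i))"
    by (rule prod.reindex_bij_witness[of _ "\<lambda>i. int i + 1" "\<lambda>k. nat (k - 1)"])
       (auto simp: nat_diff_distrib Suc_diff_Suc)
  have n: "(\<Prod>k=N-t+1..N. 1 - monom 1 (nat k) :: int poly) = (\<Prod>i<nat t. 1 - monom 1 (nat N - i))"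
    by (rule prod.reindex_bij_witness[of _ "\<lambda>i. N - int i" "\<lambda>k. nat (N - k)"])
       (use assms in \<open>auto simp: nat_diff_distrib\<close>)
  show ?thesis
    using assms gauss_denominator_dvd_nat[of "nat t" "nat N"]
    unfolding gauss_poly_def by (simp add: d n)
qed

end

theory Submission
  imports Defs
begin

text \<open>
  Write \<open>[n] = 1 + q + \<dots> + q^(n-1)\<close>. The residue sums of an integer polynomial \<open>P\<close> modulo \<open>m\<close> are
  all equal as soon as \<open>[m]\<close> divides \<open>P\<close>: multiplying a monomial by \<open>[m]\<close> spreads its
  coefficient over \<open>m\<close> consecutive exponents, that is, once over every residue class. Each residue
  sum of \<open>[m] R\<close> is therefore \<open>R(1)\<close>, while the total is \<open>P(1) = m R(1)\<close>
  (\<open>coeff_sum_mod_q_int_mult\<close>).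

  So the point is that \<open>[m]\<close> divides the polynomial \<open>P\<close> of the theorem. The \<open>q\<close>-Pascal rule
  makes the sum telescope to \<open>q^(a-m+2) P = G(b, m-1) - G(a, m-1)\<close>, where \<open>G(N, t)\<close> is the
  Gaussian polynomial (\<open>gauss_poly_telescope\<close>). The hypotheses on \<open>a\<close> and \<open>b\<close> say that \<open>a+1\<close>
  and \<open>b+1\<close> are coprime to \<open>m\<close>. The absorption identity \<open>[m] G(N+1, m) = [N+1] G(N, m-1)\<close>
  shows that \<open>[m]\<close> divides \<open>[N+1] G(N, m-1)\<close>. If \<open>N+1\<close> is coprime to \<open>m\<close>, then
  \<open>[N+1]\<close> is invertible modulo \<open>[m]\<close>, already over the integers, so \<open>[m]\<close> divides
  \<open>G(N, m-1)\<close> (\<open>q_int_dvd_gauss_poly\<close>). Finally \<open>q\<close> is invertible modulo \<open>[m]\<close> as well,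
  so the factor \<open>q^(a-m+2)\<close> can be dropped.
\<close>

section \<open>q-integers\<close>

definition q_int :: "nat \<Rightarrow> int poly" where
  "q_int n = (\<Sum>i<n. monom 1 i)"

lemma q_int_Suc: "q_int (Suc n) = 1 + monom 1 1 * q_int n"
  by (simp add: q_int_def sum.lessThan_Suc_shift sum_distrib_left mult_monom monom_0 one_pCons
      del: sum.lessThan_Suc)

lemma one_minus_q_mult_q_int: "(1 - monom 1 1) * q_int n = 1 - monom 1 n"
proof (induction n)
  case 0
  show ?case by (simp add: q_int_def monom_0 one_pCons)
next
  case (Suc n)
  have "q_int (Suc n) = q_int n + monom 1 n"
    by (simp add: q_int_def)
  then have "(1 - monom 1 1) * q_int (Suc n) = 1 - monom 1 n + (1 - monom 1 1) * monom 1 n"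
    by (simp add: Suc distrib_left del: One_nat_def)
  then show ?case
    by (simp add: algebra_simps mult_monom)
qed

lemma monom_1_neq_1: "n > 0 \<Longrightarrow> monom 1 n \<noteq> (1 :: int poly)"
  by (metis degree_1 degree_monom_eq less_irrefl one_neq_zero)

lemma poly_q_int_1: "poly (q_int n) 1 = int n"
  by (simp add: q_int_def poly_sum poly_monom)

lemma q_int_dvd_q_int_mult: "q_int n dvd q_int (n * k)"
proof -
  have "1 - monom 1 n dvd (1 - monom 1 n ^ k :: int poly)"
    by (metis dvd_triv_left one_diff_power_eq)
  then have "(1 - monom 1 1) * q_int n dvd (1 - monom 1 1) * q_int (n * k)"
    by (simp only: one_minus_q_mult_q_int monom_power power_one)
  then show ?thesis
    using monom_1_neq_1[of 1] by (simp del: One_nat_def)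
qed

text \<open>
  If \<open>n x = 1 + m y\<close>, then \<open>[n x] = 1 + q [m y]\<close> with \<open>[n]\<close> dividing \<open>[n x]\<close> and \<open>[m]\<close>
  dividing \<open>[m y]\<close>. This is a Bezout identity for \<open>[n]\<close> and \<open>[m]\<close> with integer coefficients.
\<close>

lemma q_int_dvd_mult_cancel:
  assumes "coprime m n" and dvd: "q_int m dvd q_int n * R"
  shows "q_int m dvd R"
proof (cases "n = 0")
  case True
  then have "m = 1" using assms(1) by simp
  then show ?thesis by (simp add: q_int_Suc q_int_def)
next
  case False
  from False obtain x y where xy: "n * x = m * y + gcd n m"
    using bezout_nat by blast
  have "n * x = Suc (m * y)"
    using xy assms(1) by (simp add: coprime_iff_gcd_eq_1 gcd.commute)
  moreover obtain A where "q_int (n * x) = q_int n * A"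
    using q_int_dvd_q_int_mult[of n x] by (elim dvdE)
  moreover obtain B where "q_int (m * y) = q_int m * B"
    using q_int_dvd_q_int_mult[of m y] by (elim dvdE)
  ultimately have "1 = q_int n * A - monom 1 1 * (q_int m * B)"
    using q_int_Suc[of "m * y"] by simp
  then have "R = (q_int n * A - monom 1 1 * (q_int m * B)) * R"
    by simp
  also have "\<dots> = (q_int n * R) * A - q_int m * (monom 1 1 * B * R)"
    by (simp add: algebra_simps)
  finally show ?thesis
    using dvd by (metis dvd_diff dvd_mult2 dvd_triv_left)
qed

text \<open>The identity \<open>1 = [m] - q [m-1]\<close> makes \<open>q\<close> invertible modulo \<open>[m]\<close>.\<close>

lemma q_int_dvd_monom_mult_cancel:
  assumes "m > 0"
  shows "q_int m dvd monom 1 c * P \<Longrightarrow> q_int m dvd P"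
proof (induction c)
  case 0
  then show ?case by (simp add: monom_0 flip: one_pCons)
next
  case (Suc c)
  obtain k where "m = Suc k" using assms gr0_implies_Suc by blast
  then have one: "1 = q_int m - monom 1 1 * q_int k"
    by (simp add: q_int_Suc)
  have "monom 1 (Suc c) = monom 1 1 * (monom 1 c :: int poly)"
    by (simp add: mult_monom)
  moreover have "monom 1 c * P = (q_int m - monom 1 1 * q_int k) * (monom 1 c * P)"
    by (simp flip: one del: One_nat_def)
  ultimately have "monom 1 c * P = q_int m * (monom 1 c * P) - q_int k * (monom 1 (Suc c) * P)"
    by (simp add: algebra_simps del: One_nat_def)
  then have "q_int m dvd monom 1 c * P"
    using Suc.prems by (metis dvd_diff dvd_mult dvd_triv_left)
  then show ?case by (rule Suc.IH)
qed

section \<open>Recurrences for Gaussian polynomials\<close>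

lemma q_factorial_nonzero: "(\<Prod>k=1..t. 1 - monom 1 (nat k) :: int poly) \<noteq> 0"
  using monom_1_neq_1[symmetric] by (simp add: Ball_def)

lemma q_factorial_rec:
  fixes t :: int
  assumes "1 \<le> t"
  shows "(\<Prod>k=1..t. 1 - monom 1 (nat k) :: int poly)
      = (\<Prod>k=1..t-1. 1 - monom 1 (nat k)) * (1 - monom 1 (nat t))"
proof -
  have "{1..t} = insert t {1..t-1}" using assms by auto
  then show ?thesis by (simp add: mult.commute)
qed

lemma gauss_numerator_rec:
  fixes N t :: int
  assumes "1 \<le> t"
  shows "(\<Prod>k=N-t+1..N. 1 - monom 1 (nat k) :: int poly)
      = (1 - monom 1 (nat N)) * (\<Prod>k=(N-1)-(t-1)+1..N-1. 1 - monom 1 (nat k))"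
proof -
  have "{N-t+1..N} = insert N {(N-1)-(t-1)+1..N-1}" using assms by auto
  then show ?thesis by simp
qed

lemma gauss_poly_0: "0 \<le> N \<Longrightarrow> gauss_poly N 0 = 1"
  by (simp add: gauss_poly_def)

lemma gauss_poly_absorption:
  assumes "1 \<le> t" "t \<le> N"
  shows "q_int (nat t) * gauss_poly N t = q_int (nat N) * gauss_poly (N - 1) (t - 1)"
proof -
  let ?D = "\<Prod>k=1..t-1. 1 - monom 1 (nat k) :: int poly"
  have D: "?D \<noteq> 0" by (rule q_factorial_nonzero)
  have "?D * (1 - monom 1 (nat t)) * gauss_poly N t
      = (1 - monom 1 (nat N)) * (?D * gauss_poly (N - 1) (t - 1))"
    using gauss_poly_mult_denominator[of t N] gauss_poly_mult_denominator[of "t - 1" "N - 1"] assms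
    unfolding q_factorial_rec[OF assms(1)] gauss_numerator_rec[OF assms(1)]
    by (simp add: mult.commute)
  then have "(?D * (1 - monom 1 1)) * (q_int (nat t) * gauss_poly N t)
      = (?D * (1 - monom 1 1)) * (q_int (nat N) * gauss_poly (N - 1) (t - 1))"
    by (simp only: mult_ac flip: one_minus_q_mult_q_int[of "nat t"]
        one_minus_q_mult_q_int[of "nat N"])
  then show ?thesis
    using D monom_1_neq_1[of 1] by (simp del: One_nat_def)
qed

lemma gauss_poly_Pascal:
  assumes "1 \<le> t" "t < N"
  shows "gauss_poly N t
      = gauss_poly (N - 1) t + monom 1 (nat (N - t)) * gauss_poly (N - 1) (t - 1)"
proof -
  let ?D = "\<Prod>k=1..t-1. 1 - monom 1 (nat k) :: int poly"
  let ?M = "\<Prod>k=(N-1)-(t-1)+1..N-1. 1 - monom 1 (nat k) :: int poly"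
  let ?s = "monom 1 (nat (N - t)) :: int poly" and ?x = "monom 1 (nat t) :: int poly"
  have G: "gauss_poly N t * (?D * (1 - ?x)) = (1 - monom 1 (nat N)) * ?M"
    using gauss_poly_mult_denominator[of t N] assms
    unfolding q_factorial_rec[OF assms(1)] gauss_numerator_rec[OF assms(1)] by simp
  have G': "gauss_poly (N - 1) (t - 1) * ?D = ?M"
    using gauss_poly_mult_denominator[of "t - 1" "N - 1"] assms by simp
  have "{(N-1)-t+1..N-1} = insert (N - t) {(N-1)-(t-1)+1..N-1}" using assms by auto
  then have "(\<Prod>k=(N-1)-t+1..N-1. 1 - monom 1 (nat k) :: int poly) = (1 - ?s) * ?M"
    by simp
  then have G'': "gauss_poly (N - 1) t * (?D * (1 - ?x)) = (1 - ?s) * ?M"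
    using gauss_poly_mult_denominator[of t "N - 1"] assms
    unfolding q_factorial_rec[OF assms(1)] by simp
  have "monom 1 (nat N) = ?s * ?x"
    using assms by (simp add: mult_monom flip: nat_add_distrib)
  then have "gauss_poly N t * (?D * (1 - ?x)) = (1 - ?s) * ?M + ?s * (1 - ?x) * ?M"
    unfolding G by (simp add: algebra_simps)
  also have "\<dots> = (gauss_poly (N - 1) t + ?s * gauss_poly (N - 1) (t - 1)) * (?D * (1 - ?x))"
    unfolding G''[symmetric] unfolding G'[symmetric] by (simp add: algebra_simps)
  finally show ?thesis
    using q_factorial_nonzero[of "t - 1"] monom_1_neq_1[of "nat t"] assms by simp
qed

lemma gauss_poly_telescope:
  assumes "1 \<le> t" "t \<le> a" "a \<le> b"
  shows "monom 1 (nat (a - t + 1))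
        * (\<Sum>j=a+1..b. monom 1 (nat (j - (a + 1))) * gauss_poly (j - 1) (t - 1))
      = gauss_poly b t - gauss_poly a t"
  using assms(3)
proof (induction b rule: int_ge_induct)
  case base
  show ?case by simp
next
  case (step b)
  have "{a+1..b+1} = insert (b + 1) {a+1..b}" using step by auto
  moreover have "monom 1 (nat (a - t + 1)) * (monom 1 (nat (b - a)) * gauss_poly b (t - 1))
      = monom 1 (nat (b + 1 - t)) * gauss_poly b (t - 1)"
  proof -
    have "nat (a - t + 1) + nat (b - a) = nat (b + 1 - t)"
      using assms(2) step.hyps by linarith
    then show ?thesis
      by (simp add: mult_monom flip: mult.assoc)
  qed
  ultimately show ?case
    using step gauss_poly_Pascal[of t "b + 1"] assms
    by (simp add: distrib_left)
qed

text \<open>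
  At \<open>q = 1\<close> the absorption identity becomes the one for binomial coefficients, which determines
  them by recursion on the lower index.
\<close>

lemma poly_gauss_poly_1: "poly (gauss_poly N t) 1 = int (int_binomial N t)"
proof (cases "0 \<le> t \<and> t \<le> N")
  case True
  have "poly (gauss_poly (int n) (int s)) 1 = int (n choose s)" if "s \<le> n" for n s
    using that
  proof (induction s arbitrary: n)
    case 0
    show ?case by (simp add: gauss_poly_0)
  next
    case (Suc s)
    then obtain n' where n: "n = Suc n'" and "s \<le> n'" by (cases n) auto
    have "int (Suc s) * poly (gauss_poly n (Suc s)) 1 = int (Suc n') * int (n' choose s)"
      using arg_cong[OF gauss_poly_absorption[of "int (Suc s)" "int n"], of "\<lambda>P. poly P 1"]
        Suc.prems Suc.IH[OF \<open>s \<le> n'\<close>] n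
      by (simp add: poly_q_int_1 nat_add_distrib)
    also have "\<dots> = int (Suc s) * int (n choose Suc s)"
      unfolding n using Suc_times_binomial_eq[of n' s] by (metis mult.commute of_nat_mult)
    finally show ?case
      by (simp only: mult_cancel_left) simp
  qed
  from this[of "nat t" "nat N"] show ?thesis
    using True by (auto simp: int_binomial_def)
next
  case False
  then show ?thesis by (auto simp: gauss_poly_def int_binomial_def)
qed

text \<open>
  Absorption puts the factor \<open>[m]\<close> into \<open>[N+1] G(N, m-1)\<close>, and coprimality moves it past
  \<open>[N+1]\<close>. In terms of roots: at an \<open>m\<close>-th root of unity other than \<open>1\<close>, the factor \<open>[m]\<close>
  vanishes and \<open>[N+1]\<close> does not.
\<close>

lemma q_int_dvd_gauss_poly:
  assumes "1 \<le> m" "m - 1 \<le> N" and "coprime m (N + 1)"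
  shows "q_int (nat m) dvd gauss_poly N (m - 1)"
proof -
  have "coprime (nat m) (nat (N + 1))"
    using assms by (simp add: coprime_int_iff[symmetric])
  moreover have "q_int (nat m) dvd q_int (nat (N + 1)) * gauss_poly N (m - 1)"
    using gauss_poly_absorption[of m "N + 1"] assms
    by (metis add_diff_cancel_right' diff_le_eq dvd_triv_left)
  ultimately show ?thesis by (rule q_int_dvd_mult_cancel)
qed

section \<open>Residue sums\<close>

text \<open>
  The degree bound may be replaced by any larger one, so that residue sums of different
  polynomials can be compared over the same range of exponents.
\<close>

lemma coeff_sum_mod_upto:
  assumes "degree P \<le> n"
  shows "coeff_sum_mod P m l = (\<Sum>i\<le>n. if [int i = l] (mod m) then coeff P i else 0)"
proof -
  have "coeff_sum_mod P m l = (\<Sum>i | i \<le> n \<and> [int i = l] (mod m). coeff P i)"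
    unfolding coeff_sum_mod_def using assms
    by (intro sum.mono_neutral_left) (auto intro: le_degree)
  also have "\<dots> = (\<Sum>i\<le>n. if [int i = l] (mod m) then coeff P i else 0)"
    by (simp add: sum.inter_filter flip: atMost_iff)
  finally show ?thesis .
qed

lemma coeff_sum_mod_0: "coeff_sum_mod 0 m l = 0"
  by (simp add: coeff_sum_mod_def)

lemma coeff_sum_mod_add: "coeff_sum_mod (P + Q) m l = coeff_sum_mod P m l + coeff_sum_mod Q m l"
proof -
  let ?n = "max (degree P) (degree Q)"
  have "degree (P + Q) \<le> ?n" by (rule degree_add_le_max)
  then show ?thesis
    by (auto simp: coeff_sum_mod_upto[of _ ?n] sum.distrib[symmetric] intro!: sum.cong)
qed

lemma coeff_sum_mod_smult: "coeff_sum_mod (smult c P) m l = c * coeff_sum_mod P m l"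
  using degree_smult_le[of c P]
  by (auto simp: coeff_sum_mod_upto[of _ "degree P"] sum_distrib_left intro!: sum.cong)

lemma coeff_sum_mod_pCons_0: "coeff_sum_mod (pCons 0 P) m l = coeff_sum_mod P m (l - 1)"
proof -
  have "[int (Suc i) = l] (mod m) \<longleftrightarrow> [int i = l - 1] (mod m)" for i
    using cong_add_rcancel[of "int i" 1 "l - 1" m] by (simp add: add.commute)
  then show ?thesis
    using degree_pCons_le[of 0 P]
    by (simp add: coeff_sum_mod_upto[of "pCons 0 P" "Suc (degree P)"]
        coeff_sum_mod_upto[of P "degree P"] sum.atMost_Suc_shift cong: if_cong
        del: sum.atMost_Suc of_nat_Suc)
qed

lemma coeff_sum_mod_q_int:
  assumes "1 \<le> m"
  shows "coeff_sum_mod (q_int (nat m)) m l = 1"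
proof -
  have coeff: "coeff (q_int n) i = (if i < n then 1 else 0)" for n i
    by (simp add: q_int_def coeff_sum)
  have "degree (q_int (nat m)) \<le> nat m"
    by (intro degree_le) (simp add: coeff)
  then have "coeff_sum_mod (q_int (nat m)) m l
      = (\<Sum>i\<le>nat m. if [int i = l] (mod m) then coeff (q_int (nat m)) i else 0)"
    by (rule coeff_sum_mod_upto)
  also have "\<dots> = (\<Sum>i\<le>nat m. if i = nat (l mod m) then 1 else 0)"
  proof (intro sum.cong refl)
    fix i
    have "[int i = l] (mod m) \<longleftrightarrow> i = nat (l mod m)" if "i < nat m"
      using that assms by (auto simp: cong_def)
    moreover have "nat (l mod m) < nat m" using assms by simp
    ultimately show "(if [int i = l] (mod m) then coeff (q_int (nat m)) i else 0)
        = (if i = nat (l mod m) then 1 else 0)"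
      by (auto simp: coeff)
  qed
  also have "\<dots> = 1"
    using assms pos_mod_bound[of m l] by (simp add: nat_mono order_less_imp_le)
  finally show ?thesis .
qed

text \<open>
  By linearity it is enough to look at \<open>q^k [m]\<close>, whose exponents \<open>k, \<dots>, k+m-1\<close> meet every
  residue class once. The induction over the coefficients of \<open>R\<close> shifts \<open>l\<close>, hence the
  statement for all integers \<open>l\<close>.
\<close>

lemma coeff_sum_mod_q_int_mult:
  assumes "1 \<le> m"
  shows "coeff_sum_mod (q_int (nat m) * R) m l = poly R 1"
proof (induction R arbitrary: l)
  case 0
  show ?case by (simp add: coeff_sum_mod_0)
next
  case (pCons c R)
  show ?case
    by (simp add: mult_pCons_right coeff_sum_mod_add coeff_sum_mod_smult coeff_sum_mod_pCons_0
        coeff_sum_mod_q_int[OF assms] pCons.IH)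
qed

section \<open>Equidistribution\<close>

lemma coprime_succ_if_prime_factors:
  fixes m N :: int
  assumes "\<And>p. prime p \<Longrightarrow> p dvd m \<Longrightarrow> \<not> [N = -1] (mod p)"
  shows "coprime m (N + 1)"
proof (rule ccontr)
  assume "\<not> coprime m (N + 1)"
  then have "\<not> is_unit (gcd m (N + 1))"
    by (simp add: coprime_iff_gcd_eq_1)
  then obtain p where "prime p" "p dvd gcd m (N + 1)"
    by (metis dvd_0_right gcd_eq_0_iff prime_divisor_exists two_is_prime)
  then show False
    using assms[of p] by (simp add: cong_iff_dvd_diff)
qed

theorem proposition53:
  fixes m a b l :: int
  assumes "m \<ge> 1" and "m \<le> a" and "a < b"
    and "\<And>p. prime p \<Longrightarrow> p dvd m \<Longrightarrow> \<not> [a = -1] (mod p)"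
    and "\<And>p. prime p \<Longrightarrow> p dvd m \<Longrightarrow> \<not> [b = -1] (mod p)"
    and "0 \<le> l" and "l \<le> m - 1"
  shows "(of_int (coeff_sum_mod
            (\<Sum>j=a+1..b. monom 1 (nat (j - (a + 1))) * gauss_poly (j - 1) (m - 2)) m l) :: rat)
         = 1 / of_int m * (\<Sum>j=a+1..b. of_nat (int_binomial (j - 1) (m - 2)))"
proof (cases "m = 1")
  case True
  \<comment> \<open>The lower index is \<open>-1\<close>, so every summand on both sides is zero by convention.\<close>
  then show ?thesis
    by (simp add: gauss_poly_def int_binomial_def coeff_sum_mod_0)
next
  case False
  then have m: "2 \<le> m" using assms(1) by simp
  let ?P = "\<Sum>j=a+1..b. monom 1 (nat (j - (a + 1))) * gauss_poly (j - 1) (m - 2)"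
  have "q_int (nat m) dvd gauss_poly b (m - 1) - gauss_poly a (m - 1)"
    using assms m by (intro dvd_diff q_int_dvd_gauss_poly coprime_succ_if_prime_factors) auto
  also have "\<dots> = monom 1 (nat (a - (m - 1) + 1)) * ?P"
    using gauss_poly_telescope[of "m - 1" a b] assms m by (simp add: diff_diff_eq)
  finally have "q_int (nat m) dvd ?P"
    by (rule q_int_dvd_monom_mult_cancel[rotated]) (use m in simp)
  then obtain R where R: "?P = q_int (nat m) * R" by (elim dvdE)
  have "(\<Sum>j=a+1..b. int (int_binomial (j - 1) (m - 2))) = poly ?P 1"
    by (simp add: poly_sum poly_monom poly_gauss_poly_1)
  also have "\<dots> = m * poly R 1"
    unfolding R using m by (simp add: poly_q_int_1)
  finally have "(of_int (\<Sum>j=a+1..b. int (int_binomial (j - 1) (m - 2))) :: rat)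
      = of_int (m * poly R 1)"
    by (rule arg_cong)
  then have "(\<Sum>j=a+1..b. of_nat (int_binomial (j - 1) (m - 2)) :: rat)
      = of_int m * of_int (poly R 1)"
    by simp
  moreover have "coeff_sum_mod ?P m l = poly R 1"
    unfolding R using assms(1) by (rule coeff_sum_mod_q_int_mult)
  ultimately show ?thesis using m by simp
qed

end
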